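(* Let $D>1$ be an integer and let $A$ be a prime $D\times D$ integer matrix that is not unimodular. Then its unique Hermite normal form $H=(h_{mn})$, where $A=HU$ for some unimodular matrix $U$, satisfies: 1) $H$ is lower triangular, i.e., $h_{mn}=0$ if $n>m$; 2) there is one and only one diagonal element that is not $1$, i.e., there exists one and only one $m_0$, $1\le m_0\le D$, such that $h_{m_0m_0}=\lambda_D>1$, where $\lambda_D$ is a prime integer, and $h_{mm}=1$ for all $m\neq m_0$; 3) for this $m_0$ and every $m\ne m_0$, all elements of the $m$th row to the left of the diagonal element $h_{mm}=1$ are $0$, i.e., $h_{mn}=0$ for all $1\le n<m$; 4) all elements of the $m_0$th row to the left of the diagonal element $h_{m_0m_0}$ are nonnegative and strictly less than $h_{m_0m_0}=\lambda_D$, i.e., $0\le h_{m_0n}<h_{m_0m_0}$ for $1\le n<m_0$. That is, $$H=\left(\begin{array}{ccccccc} 1 & \cdots & 0 & 0 & 0 & \cdots & 0\\ & \ddots & & \vdots & \vdots & & \vdots\\ 0 & \cdots & 1 & 0 & 0 & \cdots & 0\\ a_1 & \cdots & a_k & \lambda_D & 0 & \cdots & 0\\ 0 & \cdots & 0 & 0 & 1 & \cdots & 0\\ \vdots & & \vdots & \vdots & & \ddots & \\ 0 & \cdots & 0 & 0 & 0 & \cdots & 1 \end{array}\right),$$ where the row containing $\lambda_D$ is the $m_0$th row, $k=m_0-1$, and $0\le a_1,\dots,a_k<\lambda_D$ are integers (which do not appear if $m_0=1$).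
   Context: All matrices are $D\times D$ with entries in $\mathbb{Z}$. A matrix is unimodular if its determinant is $1$ or $-1$, and non-unimodular otherwise. A nonsingular integer matrix $A$ is called prime if it cannot be factorized as a product of two non-unimodular integer matrices. The Hermite normal form of a nonsingular integer matrix $A$ is the unique matrix $H=(h_{mn})$ such that $A=HU$ for some unimodular $U$, $H$ is lower triangular with positive diagonal entries, and $0\le h_{mn}<h_{mm}$ for all $1\le n<m\le D$. *)

theory Defs
  imports "Jordan_Normal_Form.Determinant" "HOL-Computational_Algebra.Primes"
begin

definition unimodular_mat :: "int mat \<Rightarrow> bool" where
  "unimodular_mat M \<longleftrightarrow> det M = 1 \<or> det M = - 1"

(* Unimodular matrices are not excluded: they satisfy this predicate. *)
definition prime_mat :: "nat \<Rightarrow> int mat \<Rightarrow> bool" where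
  "prime_mat D A \<longleftrightarrow>
     A \<in> carrier_mat D D \<and> det A \<noteq> 0 \<and>
     \<not> (\<exists>B \<in> carrier_mat D D. \<exists>C \<in> carrier_mat D D.
          A = B * C \<and> \<not> unimodular_mat B \<and> \<not> unimodular_mat C)"

(* Column-style, lower triangular Hermite normal form; row and column indices start at 0. *)
definition is_hermite_normal_form :: "nat \<Rightarrow> int mat \<Rightarrow> int mat \<Rightarrow> bool" where
  "is_hermite_normal_form D A H \<longleftrightarrow>
     H \<in> carrier_mat D D \<and>
     (\<exists>U \<in> carrier_mat D D. unimodular_mat U \<and> A = H * U) \<and>
     (\<forall>m<D. \<forall>n<D. m < n \<longrightarrow> H $$ (m, n) = 0) \<and>
     (\<forall>m<D. 0 < H $$ (m, m)) \<and>
     (\<forall>m<D. \<forall>n<m. 0 \<le> H $$ (m, n) \<and> H $$ (m, n) < H $$ (m, m))"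

end

(* The columns of H form a reduced echelon basis of the lattice spanned by the columns of A. In the
   sublattice of vectors whose first m entries vanish, the leading entries are the multiples of the
   m-th diagonal entry of H; this yields both existence (choose vectors with minimal positive leading
   entry and reduce them) and uniqueness (compare two reduced bases). If A is prime, so is H. A lower
   triangular matrix can be split at any row k, and there along any factorization of its k-th diagonal
   entry, so primality leaves room for only one diagonal entry other than 1, and that entry is a prime
   number. The reduction inequalities then kill every other row. *)
theory Submission
  imports Defs
begin

section \<open>Reduced echelon bases of integer lattices\<close>

definition col_lattice :: "int mat \<Rightarrow> int vec set" where
  "col_lattice A = {A *\<^sub>v x | x. x \<in> carrier_vec (dim_col A)}"

text \<open>Closure under \<open>v - c \<cdot>\<^sub>v w\<close> keeps Euclidean division inside
  \<open>L\<close>. A remainder modulo a vector with least positive entry at \<open>m\<close> cannot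
  be a smaller candidate, so it vanishes at \<open>m\<close>; this is the divisibility claim. The
  bounds come from further divisions, which leave the leading entries alone.\<close>

lemma reduced_lattice_basis:
  fixes L :: "int vec set"
  assumes carr: "L \<subseteq> carrier_vec D"
    and comb: "\<And>v w c. v \<in> L \<Longrightarrow> w \<in> L \<Longrightarrow> v - c \<cdot>\<^sub>v w \<in> L"
    and pos: "\<And>m. m < D \<Longrightarrow> \<exists>v\<in>L. (\<forall>i<m. v $ i = 0) \<and> 0 < v $ m"
  obtains h where "\<And>m. m < D \<Longrightarrow> h m \<in> L"
    and "\<And>m i. m < D \<Longrightarrow> i < m \<Longrightarrow> h m $ i = 0"
    and "\<And>m. m < D \<Longrightarrow> 0 < h m $ m"
    and "\<And>m k. m < k \<Longrightarrow> k < D \<Longrightarrow> 0 \<le> h m $ k \<and> h m $ k < h k $ k"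
    and "\<And>m v. m < D \<Longrightarrow> v \<in> L \<Longrightarrow> (\<And>i. i < m \<Longrightarrow> v $ i = 0) \<Longrightarrow> h m $ m dvd v $ m"
proof -
  define P where "P m v \<longleftrightarrow> v \<in> L \<and> (\<forall>i<m. v $ i = 0) \<and> 0 < v $ m" for m v
  have entry: "(v - c \<cdot>\<^sub>v w) $ i = v $ i - c * w $ i" if "v \<in> L" "w \<in> L" "i < D" for v w c i
  proof -
    have "v \<in> carrier_vec D" "w \<in> carrier_vec D" using that carr by auto
    then show ?thesis using that by simp
  qed
  have "\<exists>v. P m v \<and> (\<forall>w. P m w \<longrightarrow> v $ m \<le> w $ m)" if m: "m < D" for m
  proof -
    obtain v0 where "P m v0" using pos[OF m] by (auto simp: P_def)
    then obtain v where "P m v" and "\<forall>w. P m w \<longrightarrow> nat (v $ m) \<le> nat (w $ m)"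
      using ex_has_least_nat[of "P m" v0 "\<lambda>v. nat (v $ m)"] by auto
    then show ?thesis by (intro exI[of _ v]) (auto simp: P_def)
  qed
  then obtain g where gP: "\<And>m. m < D \<Longrightarrow> P m (g m)"
    and gmin: "\<And>m w. m < D \<Longrightarrow> P m w \<Longrightarrow> g m $ m \<le> w $ m" by metis
  have gdvd: "g m $ m dvd v $ m" if m: "m < D" and v: "v \<in> L" "\<And>i. i < m \<Longrightarrow> v $ i = 0" for m v
  proof -
    \<comment> \<open>The entry of \<open>w\<close> at \<open>m\<close> is the remainder of
      \<open>v $ m\<close> modulo \<open>g m $ m\<close>. Were it positive, \<open>w\<close> would
      contradict the minimality of \<open>g m\<close>.\<close>
    define w where "w = v - (v $ m div g m $ m) \<cdot>\<^sub>v g m"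
    have g: "g m \<in> L" "\<And>i. i < m \<Longrightarrow> g m $ i = 0" "0 < g m $ m" using gP[OF m] by (auto simp: P_def)
    have wm: "w $ m = v $ m mod g m $ m"
      by (simp add: w_def entry v g m minus_div_mult_eq_mod)
    have "w \<in> L" unfolding w_def by (intro comb v g)
    moreover have "\<forall>i<m. w $ i = 0" using m by (simp add: w_def entry v g)
    ultimately have "P m w" if "0 < w $ m" using that by (simp add: P_def)
    then have "\<not> 0 < w $ m"
      using gmin[OF m, of w] wm g(3) pos_mod_bound[of "g m $ m" "v $ m"] by linarith
    then have "v $ m mod g m $ m = 0" using wm g(3) pos_mod_sign[of "g m $ m" "v $ m"] by linarith
    then show ?thesis by auto
  qed
  \<comment> \<open>The entries after \<open>m\<close> are reduced in increasing order of position: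
    subtracting a multiple of \<open>g k\<close> changes nothing before position \<open>k\<close>,
    so reductions already made survive. The leading entry stays that of \<open>g m\<close>, hence
    bounds against \<open>g\<close> are also bounds against the final \<open>h\<close>.\<close>
  have "\<exists>v\<in>L. (\<forall>i<m. v $ i = 0) \<and> v $ m = g m $ m \<and>
      (\<forall>j. m < j \<and> j < k \<longrightarrow> 0 \<le> v $ j \<and> v $ j < g j $ j)" if m: "m < D" and "k \<le> D" for m k
    using \<open>k \<le> D\<close>
  proof (induction k)
    case 0
    show ?case using gP[OF m] by (auto simp: P_def)
  next
    case (Suc k)
    then obtain v where v: "v \<in> L" "\<forall>i<m. v $ i = 0" "v $ m = g m $ m"
      "\<forall>j. m < j \<and> j < k \<longrightarrow> 0 \<le> v $ j \<and> v $ j < g j $ j" by auto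
    have k: "k < D" using Suc.prems by simp
    show ?case
    proof (cases "m < k")
      case False
      then show ?thesis using v by (intro bexI[of _ v]) auto
    next
      case True
      have g: "g k \<in> L" "\<And>i. i < k \<Longrightarrow> g k $ i = 0" "0 < g k $ k" using gP[OF k] by (auto simp: P_def)
      define w where "w = v - (v $ k div g k $ k) \<cdot>\<^sub>v g k"
      have "w \<in> L" unfolding w_def by (intro comb v g)
      moreover have low: "w $ i = v $ i" if "i < k" for i
        using that k by (simp add: w_def entry v(1) g)
      moreover have "w $ k = v $ k mod g k $ k"
        by (simp add: w_def entry v(1) g k minus_div_mult_eq_mod)
      ultimately show ?thesis using v True g(3)
        by (intro bexI[of _ w]) (auto simp: less_Suc_eq)
    qed
  qed
  from this[OF _ order_refl] obtain h where h: "\<And>m. m < D \<Longrightarrow> h m \<in> L \<and> (\<forall>i<m. h m $ i = 0)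
      \<and> h m $ m = g m $ m \<and> (\<forall>j. m < j \<and> j < D \<longrightarrow> 0 \<le> h m $ j \<and> h m $ j < g j $ j)"
    by metis
  have gpos: "\<And>m. m < D \<Longrightarrow> 0 < g m $ m" using gP by (auto simp: P_def)
  show thesis
  proof (rule that[of h])
    fix m k assume "m < k" "k < D"
    then show "0 \<le> h m $ k \<and> h m $ k < h k $ k" using h[of m] h[of k] by auto
  next
    fix m v assume "m < D" "v \<in> L" "\<And>i. i < m \<Longrightarrow> v $ i = 0"
    then show "h m $ m dvd v $ m" using h gdvd by metis
  qed (use h gpos in auto)
qed

section \<open>Splitting a lower triangular matrix at a row\<close>

text \<open>\<open>B\<close> keeps the rows of \<open>H\<close> up to \<open>k\<close>,
  \<open>C\<close> keeps the later ones, and identity rows fill the gaps; the diagonal entry at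
  \<open>k\<close> is shared out as \<open>b\<close> and \<open>c\<close>. Both factors are lower
  triangular, so their determinants can be read off.\<close>

lemma lower_triangular_factorization:
  fixes H :: "int mat"
  assumes H: "H \<in> carrier_mat D D" and low: "\<And>i j. i < j \<Longrightarrow> j < D \<Longrightarrow> H $$ (i, j) = 0"
    and k: "k < D" and bc: "H $$ (k, k) = b * c"
  obtains B C where "B \<in> carrier_mat D D" "C \<in> carrier_mat D D" "H = B * C"
    "det B = b * (\<Prod>i<k. H $$ (i, i))" "det C = c * (\<Prod>i=Suc k..<D. H $$ (i, i))"
proof -
  define B where "B = mat D D (\<lambda>(i, j). if i = k \<and> j = k then b else if i \<le> k then H $$ (i, j)
    else if i = j then 1 else 0)"
  define C where "C = mat D D (\<lambda>(i, j). if i = k \<and> j = k then c else if k < i then H $$ (i, j)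
    else if i = j then 1 else 0)"
  have B: "B \<in> carrier_mat D D" and C: "C \<in> carrier_mat D D" by (auto simp: B_def C_def)
  have "H = B * C"
  proof (rule eq_matI)
    fix i j assume "i < dim_row (B * C)" "j < dim_col (B * C)"
    then have ij: "i < D" "j < D" using B C by auto
    have BC: "(B * C) $$ (i, j) = (\<Sum>n<D. B $$ (i, n) * C $$ (n, j))"
      using ij B C by (simp add: scalar_prod_def lessThan_atLeast0)
    show "H $$ (i, j) = (B * C) $$ (i, j)"
    proof (cases "k < i")
      case True
      \<comment> \<open>Row \<open>i\<close> of \<open>B\<close> is a unit vector here and picks out
        row \<open>i\<close> of \<open>C\<close>.\<close>
      then have "(\<Sum>n<D. B $$ (i, n) * C $$ (n, j)) = (\<Sum>n<D. if n = i then H $$ (i, j) else 0)"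
        by (intro sum.cong) (use ij k in \<open>auto simp: B_def C_def\<close>)
      then show ?thesis using ij by (simp add: BC)
    next
      case False
      \<comment> \<open>Row \<open>i\<close> of \<open>B\<close> is supported on columns up to
        \<open>k\<close>, and the rows of \<open>C\<close> up to \<open>k\<close> are diagonal, so
        only \<open>n = j\<close> can contribute.\<close>
      then have "(\<Sum>n<D. B $$ (i, n) * C $$ (n, j)) = (\<Sum>n<D. if n = j then H $$ (i, j) else 0)"
        by (intro sum.cong) (use ij k low bc in \<open>auto simp: B_def C_def\<close>)
      then show ?thesis using ij by (simp add: BC)
    qed
  qed (use B C H in auto)
  have split: "(\<Prod>i<D. f i) = (\<Prod>i<k. f i) * f k * (\<Prod>i=Suc k..<D. f i)" for f :: "nat \<Rightarrow> int"
    using prod.atLeastLessThan_concat[of 0 "Suc k" D f] k by (simp add: lessThan_atLeast0)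
  have det: "det M = (\<Prod>i<D. M $$ (i, i))"
    if "M \<in> carrier_mat D D" "\<And>i j. i < j \<Longrightarrow> j < D \<Longrightarrow> M $$ (i, j) = 0" for M :: "int mat"
    using that by (simp add: det_lower_triangular[OF that(2) that(1)] prod_list_diag_prod lessThan_atLeast0)
  have "det B = b * (\<Prod>i<k. H $$ (i, i))"
    using k low by (subst det[OF B]) (auto simp: B_def split)
  moreover have "det C = c * (\<Prod>i=Suc k..<D. H $$ (i, i))"
    using k low by (subst det[OF C]) (auto simp: C_def split)
  ultimately show thesis using that B C \<open>H = B * C\<close> by blast
qed

section \<open>Column lattices and unimodular changes of basis\<close>

lemma col_lattice_carrier:
  assumes "A \<in> carrier_mat n D"
  shows "col_lattice A \<subseteq> carrier_vec n"
  using assms by (auto simp: col_lattice_def)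

lemma col_lattice_diff_smult:
  assumes A: "A \<in> carrier_mat n D" and v: "v \<in> col_lattice A" and w: "w \<in> col_lattice A"
  shows "v - c \<cdot>\<^sub>v w \<in> col_lattice A"
proof -
  obtain x y where x: "x \<in> carrier_vec D" "v = A *\<^sub>v x" and y: "y \<in> carrier_vec D" "w = A *\<^sub>v y"
    using A v w by (auto simp: col_lattice_def)
  have "c \<cdot>\<^sub>v w = A *\<^sub>v (c \<cdot>\<^sub>v y)"
    using A y by (intro eq_vecI) (auto simp: scalar_prod_smult_right)
  then have "v - c \<cdot>\<^sub>v w = A *\<^sub>v (x - c \<cdot>\<^sub>v y)"
    using A x y by (simp add: mult_minus_distrib_mat_vec)
  then show ?thesis using A x y by (auto simp: col_lattice_def)
qed

lemma col_in_col_lattice: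
  assumes A: "A \<in> carrier_mat n D" and j: "j < D"
  shows "col A j \<in> col_lattice A"
proof -
  have "col A j = A *\<^sub>v unit_vec D j"
    using A j by (intro eq_vecI) auto
  then show ?thesis using A by (auto simp: col_lattice_def)
qed

text \<open>The coefficient vectors of the columns of \<open>A\<close> serve as the columns of
  \<open>X\<close>. This turns inclusions of lattices into matrix factorizations.\<close>

lemma col_lattice_cols_factor:
  assumes A: "A \<in> carrier_mat n k" and B: "B \<in> carrier_mat n D"
    and cols: "\<And>j. j < k \<Longrightarrow> col A j \<in> col_lattice B"
  obtains X where "X \<in> carrier_mat D k" "A = B * X"
proof -
  have "\<exists>x\<in>carrier_vec D. col A j = B *\<^sub>v x" if "j < k" for j
    using cols[OF that] B by (auto simp: col_lattice_def)
  then obtain x where x: "\<And>j. j < k \<Longrightarrow> x j \<in> carrier_vec D"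
    "\<And>j. j < k \<Longrightarrow> col A j = B *\<^sub>v x j" by metis
  define X where "X = mat D k (\<lambda>(i, j). x j $ i)"
  have X: "X \<in> carrier_mat D k" by (simp add: X_def)
  have colX: "col X j = x j" if "j < k" for j
    using that x(1)[OF that] by (intro eq_vecI) (auto simp: X_def)
  have "A = B * X"
  proof (rule mat_col_eqI)
    fix j assume "j < dim_col (B * X)"
    then have j: "j < k" using X by simp
    show "col A j = col (B * X) j" using col_mult2[OF B X j] colX[OF j] x(2)[OF j] by simp
  qed (use A B X in auto)
  with X show thesis by (rule that)
qed

text \<open>Since \<open>det U\<close> squares to 1, scaling the adjugate by \<open>det U\<close>
  does the work of dividing by it and stays integral.\<close>

lemma unimodular_mat_right_inverse:
  assumes U: "U \<in> carrier_mat D D" and uni: "unimodular_mat U"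
  obtains V where "V \<in> carrier_mat D D" "U * V = 1\<^sub>m D"
proof
  show "det U \<cdot>\<^sub>m adj_mat U \<in> carrier_mat D D" using adj_mat(1)[OF U] by simp
  have "U * (det U \<cdot>\<^sub>m adj_mat U) = det U \<cdot>\<^sub>m (det U \<cdot>\<^sub>m 1\<^sub>m D)"
    using mult_smult_distrib[OF U adj_mat(1)[OF U]] adj_mat(2)[OF U] by simp
  also have "\<dots> = 1\<^sub>m D" using uni by (intro eq_matI) (auto simp: unimodular_mat_def)
  finally show "U * (det U \<cdot>\<^sub>m adj_mat U) = 1\<^sub>m D" .
qed

text \<open>\<open>U\<close> only substitutes coefficient vectors, and invertibly so. Hence every
  Hermite normal form of a matrix has the same column lattice as that matrix.\<close>

lemma col_lattice_mult_unimodular: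
  assumes H: "H \<in> carrier_mat n D" and U: "U \<in> carrier_mat D D" and uni: "unimodular_mat U"
  shows "col_lattice (H * U) = col_lattice H"
proof (intro equalityI subsetI)
  fix v assume "v \<in> col_lattice (H * U)"
  then obtain x where x: "x \<in> carrier_vec D" "v = (H * U) *\<^sub>v x"
    using U by (auto simp: col_lattice_def)
  then have "v = H *\<^sub>v (U *\<^sub>v x)" "U *\<^sub>v x \<in> carrier_vec D" using H U by auto
  then show "v \<in> col_lattice H" using H by (auto simp: col_lattice_def)
next
  fix v assume "v \<in> col_lattice H"
  then obtain x where x: "x \<in> carrier_vec D" "v = H *\<^sub>v x"
    using H by (auto simp: col_lattice_def)
  obtain V where V: "V \<in> carrier_mat D D" "U * V = 1\<^sub>m D"
    using unimodular_mat_right_inverse[OF U uni] .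
  have "(H * U) *\<^sub>v (V *\<^sub>v x) = H *\<^sub>v ((U * V) *\<^sub>v x)" using H U V(1) x by simp
  then have "v = (H * U) *\<^sub>v (V *\<^sub>v x)" using V(2) x by simp
  moreover have "V *\<^sub>v x \<in> carrier_vec (dim_col (H * U))" using V(1) U x by simp
  ultimately show "v \<in> col_lattice (H * U)" unfolding col_lattice_def by blast
qed

section \<open>Existence of the Hermite normal form\<close>

text \<open>A reduced basis of the column lattice of \<open>A\<close> supplies the columns of
  \<open>H\<close>. As \<open>A\<close> and \<open>H\<close> span the same lattice, each is a right
  multiple of the other, which forces the transforming matrix to be unimodular.\<close>

lemma hermite_normal_form_exists:
  assumes A: "A \<in> carrier_mat D D" and det: "det A \<noteq> 0"
  shows "\<exists>H. is_hermite_normal_form D A H"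
proof -
  note comb = col_lattice_diff_smult[OF A]
  have pos: "\<exists>v\<in>col_lattice A. (\<forall>i<m. v $ i = 0) \<and> 0 < v $ m" if m: "m < D" for m
  proof -
    \<comment> \<open>The extra factor \<open>det A\<close> makes \<open>A * X\<close> equal to the
      square of \<open>det A\<close> times the identity, so the diagonal is positive whatever the
      sign of \<open>det A\<close>.\<close>
    define X where "X = det A \<cdot>\<^sub>m adj_mat A"
    have X: "X \<in> carrier_mat D D" using adj_mat(1)[OF A] by (simp add: X_def)
    have "A * X = det A \<cdot>\<^sub>m (det A \<cdot>\<^sub>m 1\<^sub>m D)"
      unfolding X_def using mult_smult_distrib[OF A adj_mat(1)[OF A]] adj_mat(2)[OF A] by simp
    then have "col (A * X) m $ i = (if i = m then det A * det A else 0)" if "i < D" for i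
      using that m by simp
    moreover have "col (A * X) m \<in> col_lattice A"
      using col_mult2[OF A X m] A X m by (auto simp: col_lattice_def)
    moreover have "0 < det A * det A" using det by (auto simp: zero_less_mult_iff)
    ultimately show ?thesis using m by (intro bexI[of _ "col (A * X) m"]) auto
  qed
  obtain h where hL: "\<And>m. m < D \<Longrightarrow> h m \<in> col_lattice A"
    and h0: "\<And>m i. m < D \<Longrightarrow> i < m \<Longrightarrow> h m $ i = 0"
    and hpos: "\<And>m. m < D \<Longrightarrow> 0 < h m $ m"
    and hred: "\<And>m k. m < k \<Longrightarrow> k < D \<Longrightarrow> 0 \<le> h m $ k \<and> h m $ k < h k $ k"
    and hdvd: "\<And>m v. m < D \<Longrightarrow> v \<in> col_lattice A \<Longrightarrow> (\<And>i. i < m \<Longrightarrow> v $ i = 0) \<Longrightarrow> h m $ m dvd v $ m"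
    using reduced_lattice_basis[OF col_lattice_carrier[OF A] comb pos] by blast
  have hc: "h m \<in> carrier_vec D" if "m < D" for m using hL[OF that] col_lattice_carrier[OF A] by auto
  define H where "H = mat D D (\<lambda>(i, j). h j $ i)"
  have H: "H \<in> carrier_mat D D" by (simp add: H_def)
  have colH: "col H j = h j" if "j < D" for j
    using that hc[OF that] by (intro eq_vecI) (auto simp: H_def)
  \<comment> \<open>Induction on the number \<open>k\<close> of trailing positions that may be
    nonzero: a multiple of \<open>h m\<close>, for \<open>m = D - Suc k\<close>, clears the first of
    them. The case \<open>k = D\<close> covers the whole lattice of \<open>A\<close>.\<close>
  have gen: "v \<in> col_lattice H" if "k \<le> D" "v \<in> col_lattice A" "\<forall>i<D - k. v $ i = 0" for k v
    using that
  proof (induction k arbitrary: v)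
    case 0
    then have "v \<in> carrier_vec D" using col_lattice_carrier[OF A] by auto
    then have "v = H *\<^sub>v 0\<^sub>v D" using 0 H by (intro eq_vecI) auto
    then show ?case using H by (auto simp: col_lattice_def)
  next
    case (Suc k)
    define m where "m = D - Suc k"
    have m: "m < D" "D - k = Suc m" using Suc.prems by (auto simp: m_def)
    obtain q where q: "v $ m = h m $ m * q"
      using hdvd[OF m(1) Suc.prems(2)] Suc.prems(3) by (auto simp: m_def elim: dvdE)
    define w where "w = v - q \<cdot>\<^sub>v h m"
    have vc: "v \<in> carrier_vec D" using Suc.prems col_lattice_carrier[OF A] by auto
    have ent: "w $ i = v $ i - q * h m $ i" if "i < D" for i
      using that hc[OF m(1)] vc by (simp add: w_def)
    have "w \<in> col_lattice A" unfolding w_def using Suc.prems hL[OF m(1)] by (intro comb)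
    moreover have "\<forall>i<D - k. w $ i = 0"
    proof (intro allI impI)
      fix i assume "i < D - k"
      then consider "i < m" | "i = m" using m(2) by linarith
      then show "w $ i = 0"
      proof cases
        case 1
        then show ?thesis using ent[of i] h0[OF m(1) 1] Suc.prems(3) m(1) by (simp add: m_def)
      next
        case 2
        then show ?thesis using ent[of m] q m(1) by simp
      qed
    qed
    ultimately have "w \<in> col_lattice H" using Suc by simp
    moreover have "h m \<in> col_lattice H" using col_in_col_lattice[OF H m(1)] colH[OF m(1)] by simp
    \<comment> \<open>The coefficient \<open>- q\<close> lets closure under differences add the
      multiple of \<open>h m\<close> back.\<close>
    ultimately have "w - (- q) \<cdot>\<^sub>v h m \<in> col_lattice H" by (rule col_lattice_diff_smult[OF H])
    moreover have "w - (- q) \<cdot>\<^sub>v h m = v"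
      using vc hc[OF m(1)] by (intro eq_vecI) (auto simp: w_def)
    ultimately show ?case by simp
  qed
  have "\<And>j. j < D \<Longrightarrow> col A j \<in> col_lattice H"
    using gen[of D] col_in_col_lattice[OF A] by simp
  from col_lattice_cols_factor[OF A H this]
  obtain U where U: "U \<in> carrier_mat D D" "A = H * U" by blast
  have "\<And>j. j < D \<Longrightarrow> col H j \<in> col_lattice A" using hL colH by simp
  from col_lattice_cols_factor[OF H A this]
  obtain V where V: "V \<in> carrier_mat D D" "H = A * V" by blast
  \<comment> \<open>Cancelling the nonzero \<open>det A\<close> leaves \<open>det U\<close> as a
    divisor of 1.\<close>
  have "det A = det A * (det V * det U)"
    using det_mult[OF H U(1), folded U(2)] det_mult[OF A V(1), folded V(2)] by simp
  then have "det U dvd 1" using det by (metis dvd_triv_right mult_cancel_left2)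
  then have "unimodular_mat U" by (auto simp: unimodular_mat_def)
  then have "is_hermite_normal_form D A H"
    unfolding is_hermite_normal_form_def using U H h0 hpos hred by (auto simp: H_def)
  then show ?thesis by blast
qed

section \<open>Uniqueness of the Hermite normal form\<close>

text \<open>Forward substitution: the nonzero diagonal forces the coefficients before
  \<open>m\<close> to vanish one after another, and triangularity removes the later terms of row
  \<open>m\<close>.\<close>

lemma lower_triangular_mult_vec:
  fixes H :: "int mat"
  assumes H: "H \<in> carrier_mat D D" and low: "\<forall>m<D. \<forall>n<D. m < n \<longrightarrow> H $$ (m, n) = 0"
    and diag: "\<forall>m<D. 0 < H $$ (m, m)"
    and x: "x \<in> carrier_vec D" and m: "m < D" and zero: "\<And>i. i < m \<Longrightarrow> (H *\<^sub>v x) $ i = 0"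
  shows "(H *\<^sub>v x) $ m = H $$ (m, m) * x $ m"
proof -
  have lead: "(H *\<^sub>v x) $ i = H $$ (i, i) * x $ i" if i: "i < D" and xz: "\<And>j. j < i \<Longrightarrow> x $ j = 0" for i
  proof -
    have "(H *\<^sub>v x) $ i = (\<Sum>j<D. H $$ (i, j) * x $ j)"
      using i H x by (simp add: scalar_prod_def lessThan_atLeast0)
    also have "\<dots> = (\<Sum>j<D. if j = i then H $$ (i, i) * x $ i else 0)"
      by (intro sum.cong) (use i xz low in \<open>auto simp: linorder_neq_iff\<close>)
    finally show ?thesis using i by simp
  qed
  have "x $ i = 0" if "i < m" for i
    using that
  proof (induction i rule: less_induct)
    case (less i)
    then have "H $$ (i, i) * x $ i = 0" using lead[of i] zero[of i] m by simp
    moreover have "0 < H $$ (i, i)" using diag less.prems m by simp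
    ultimately show ?case by simp
  qed
  then show ?thesis using lead[OF m] by simp
qed

text \<open>This ties the diagonal of \<open>H\<close> to the lattice of \<open>A\<close> alone, so
  that two normal forms of \<open>A\<close> can be tested against each other's columns.\<close>

lemma hermite_normal_form_leading_dvd:
  assumes "is_hermite_normal_form D A H" and v: "v \<in> col_lattice A" and m: "m < D"
    and zero: "\<And>i. i < m \<Longrightarrow> v $ i = 0"
  shows "H $$ (m, m) dvd v $ m"
proof -
  obtain U where HU: "H \<in> carrier_mat D D" "U \<in> carrier_mat D D" "unimodular_mat U" "A = H * U"
    "\<forall>m<D. \<forall>n<D. m < n \<longrightarrow> H $$ (m, n) = 0" "\<forall>m<D. 0 < H $$ (m, m)"
    using assms(1) unfolding is_hermite_normal_form_def by blast
  have "v \<in> col_lattice H" using col_lattice_mult_unimodular[OF HU(1-3)] v HU(4) by simp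
  then obtain x where "x \<in> carrier_vec D" "v = H *\<^sub>v x" using HU(1) by (auto simp: col_lattice_def)
  then show ?thesis using lower_triangular_mult_vec[OF HU(1,5,6) _ m] zero by simp
qed

lemma hermite_normal_form_unique:
  assumes A: "is_hermite_normal_form D A H" and B: "is_hermite_normal_form D A K"
  shows "H = K"
proof -
  have col: "col M j \<in> col_lattice A" if M: "is_hermite_normal_form D A M" and j: "j < D" for M j
    using M col_lattice_mult_unimodular[of M D D] col_in_col_lattice[of M D D j] j
    unfolding is_hermite_normal_form_def by auto
  have H: "H \<in> carrier_mat D D" "\<And>i j. i < j \<Longrightarrow> j < D \<Longrightarrow> H $$ (i, j) = 0"
    "\<And>i. i < D \<Longrightarrow> 0 < H $$ (i, i)"
    "\<And>i j. j < i \<Longrightarrow> i < D \<Longrightarrow> 0 \<le> H $$ (i, j) \<and> H $$ (i, j) < H $$ (i, i)"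
    using A unfolding is_hermite_normal_form_def by auto
  have K: "K \<in> carrier_mat D D" "\<And>i j. i < j \<Longrightarrow> j < D \<Longrightarrow> K $$ (i, j) = 0"
    "\<And>i. i < D \<Longrightarrow> 0 < K $$ (i, i)"
    "\<And>i j. j < i \<Longrightarrow> i < D \<Longrightarrow> 0 \<le> K $$ (i, j) \<and> K $$ (i, j) < K $$ (i, i)"
    using B unfolding is_hermite_normal_form_def by auto
  have diag: "H $$ (i, i) = K $$ (i, i)" if i: "i < D" for i
  proof -
    \<comment> \<open>Column \<open>i\<close> of \<open>K\<close> is a lattice vector that vanishes
      before position \<open>i\<close>; symmetrically for \<open>H\<close>. The two positive
      diagonal entries then divide each other.\<close>
    have "H $$ (i, i) dvd col K i $ i"
      by (rule hermite_normal_form_leading_dvd[OF A col[OF B i] i]) (use K i in auto)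
    moreover have "K $$ (i, i) dvd col H i $ i"
      by (rule hermite_normal_form_leading_dvd[OF B col[OF A i] i]) (use H i in auto)
    ultimately show ?thesis using H K i by (auto intro: zdvd_antisym_nonneg simp: less_imp_le)
  qed
  have below: "H $$ (i, j) = K $$ (i, j)" if "j < i" "i < D" for i j
    using that
  proof (induction i rule: less_induct)
    case (less i)
    \<comment> \<open>Going down the rows, the two columns agree before row \<open>i\<close>, so
      \<open>H $$ (i, i)\<close> divides the difference of their entries there. Both entries are
      residues in the same range, so that difference is too small to be nonzero. The scalar 1
      matches the form of the closure lemma.\<close>
    define v where "v = col H j - 1 \<cdot>\<^sub>v col K j"
    have j: "j < D" using less.prems by simp
    have ent: "v $ l = H $$ (l, j) - K $$ (l, j)" if "l < D" for l
      using that j H K by (simp add: v_def)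
    have "v \<in> col_lattice A"
      unfolding v_def using A col[OF A j] col[OF B j]
      by (intro col_lattice_diff_smult[of A D D]) (auto simp: is_hermite_normal_form_def)
    moreover have "v $ l = 0" if "l < i" for l
      using that less j diag H(2)[of l j] K(2)[of l j] by (cases l j rule: linorder_cases) (auto simp: ent)
    ultimately have "H $$ (i, i) dvd v $ i"
      using hermite_normal_form_leading_dvd[OF A _ less.prems(2)] by blast
    moreover have "\<bar>v $ i\<bar> < H $$ (i, i)"
      using H(4)[OF less.prems] K(4)[OF less.prems] diag[OF less.prems(2)] ent[OF less.prems(2)] by linarith
    ultimately have "v $ i = 0" by (meson dvd_imp_le_int linorder_not_less order_trans abs_ge_self)
    then show ?case using ent less.prems by simp
  qed
  show ?thesis
  proof (rule eq_matI)
    fix i j assume "i < dim_row K" "j < dim_col K"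
    then have "i < D" "j < D" using K by auto
    then show "H $$ (i, j) = K $$ (i, j)"
      using diag below H(2) K(2) by (cases i j rule: linorder_cases) auto
  qed (use H K in auto)
qed

section \<open>Primality and the diagonal of the normal form\<close>

text \<open>A factorization \<open>H = B * C\<close> yields \<open>H * U = B * (C * U)\<close>, and
  \<open>U\<close> changes the determinant of the second factor at most by a sign.\<close>

lemma prime_mat_cancel_unimodular:
  assumes H: "H \<in> carrier_mat D D" and U: "U \<in> carrier_mat D D" and uni: "unimodular_mat U"
    and "prime_mat D (H * U)"
  shows "prime_mat D H"
  unfolding prime_mat_def
proof (intro conjI notI)
  show "H \<in> carrier_mat D D" by (fact H)
  show False if "det H = 0" using assms(4) that by (simp add: prime_mat_def det_mult[OF H U])
  assume "\<exists>B\<in>carrier_mat D D. \<exists>C\<in>carrier_mat D D.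
    H = B * C \<and> \<not> unimodular_mat B \<and> \<not> unimodular_mat C"
  then obtain B C where BC: "B \<in> carrier_mat D D" "C \<in> carrier_mat D D" "H = B * C"
    "\<not> unimodular_mat B" "\<not> unimodular_mat C" by blast
  have "H * U = B * (C * U)" using BC U by simp
  moreover have "\<not> unimodular_mat (C * U)"
    using BC(5) uni by (auto simp: unimodular_mat_def det_mult[OF BC(2) U])
  ultimately show False using assms(4) BC U by (auto simp: prime_mat_def)
qed

text \<open>Some diagonal entry differs from 1 because \<open>det H\<close> does. Two such entries
  could be separated into two non-unimodular factors, and a proper factorization of a single one
  would likewise split \<open>H\<close>.\<close>

lemma prime_hermite_normal_form_diagonal:
  assumes herm: "is_hermite_normal_form D A H" and prime: "prime_mat D A"
    and nonuni: "\<not> unimodular_mat A"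
  obtains k where "k < D" "H $$ (k, k) > 1" "prime (H $$ (k, k))"
    "\<And>i. i < D \<Longrightarrow> i \<noteq> k \<Longrightarrow> H $$ (i, i) = 1"
proof -
  obtain U where H: "H \<in> carrier_mat D D" and low: "\<And>i j. i < j \<Longrightarrow> j < D \<Longrightarrow> H $$ (i, j) = 0"
    and pos: "\<And>i. i < D \<Longrightarrow> 0 < H $$ (i, i)"
    and U: "U \<in> carrier_mat D D" "unimodular_mat U" "A = H * U"
    using herm unfolding is_hermite_normal_form_def by auto
  have primeH: "prime_mat D H" using prime_mat_cancel_unimodular[OF H U(1,2)] prime U(3) by simp
  have factor: "\<bar>b * (\<Prod>i<k. H $$ (i, i))\<bar> = 1 \<or> \<bar>c * (\<Prod>i=Suc k..<D. H $$ (i, i))\<bar> = 1"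
    if k: "k < D" and bc: "H $$ (k, k) = b * c" for k b c
  proof -
    obtain B C where "B \<in> carrier_mat D D" "C \<in> carrier_mat D D" "H = B * C"
      "det B = b * (\<Prod>i<k. H $$ (i, i))" "det C = c * (\<Prod>i=Suc k..<D. H $$ (i, i))"
      using lower_triangular_factorization[OF H low k bc] .
    moreover from this have "unimodular_mat B \<or> unimodular_mat C"
      using primeH unfolding prime_mat_def by blast
    ultimately show ?thesis by (auto simp: unimodular_mat_def)
  qed
  have "det H = (\<Prod>i<D. H $$ (i, i))"
    using H by (simp add: det_lower_triangular[OF low H] prod_list_diag_prod lessThan_atLeast0)
  \<comment> \<open>Otherwise \<open>det A\<close> would equal \<open>det U\<close>, making
    \<open>A\<close> unimodular.\<close>
  moreover have "det H \<noteq> 1"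
    using nonuni U by (auto simp: unimodular_mat_def det_mult[OF H U(1)])
  ultimately obtain k where k: "k < D" "H $$ (k, k) \<noteq> 1"
    by (auto elim: prod.not_neutral_contains_not_neutral)
  have unit_factor: "\<bar>x\<bar> = 1" if "\<bar>x * y\<bar> = 1" for x y :: int
    using that by (auto simp: abs_mult zmult_eq_1_iff)
  have no_two: "H $$ (i, i) = 1 \<or> H $$ (j, j) = 1" if "i < j" "j < D" for i j
  proof -
    \<comment> \<open>The split at row \<open>i\<close> with \<open>c = 1\<close> leaves the entry
      at \<open>i\<close> entirely in the first factor, while the entry at \<open>j\<close> falls
      into the second.\<close>
    have "\<bar>H $$ (i, i)\<bar> = 1 \<or> \<bar>\<Prod>l=Suc i..<D. H $$ (l, l)\<bar> = 1"
      using factor[of i "H $$ (i, i)" 1] that unit_factor[of "H $$ (i, i)"] by auto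
    moreover have "(\<Prod>l=Suc i..<D. H $$ (l, l)) = H $$ (j, j) * (\<Prod>l\<in>{Suc i..<D} - {j}. H $$ (l, l))"
      using that by (intro prod.remove) auto
    ultimately have "\<bar>H $$ (i, i)\<bar> = 1 \<or> \<bar>H $$ (j, j)\<bar> = 1"
      using unit_factor[of "H $$ (j, j)"] by metis
    then show ?thesis using pos[of i] pos[of j] that by auto
  qed
  have others: "H $$ (i, i) = 1" if "i < D" "i \<noteq> k" for i
    using no_two[of i k] no_two[of k i] k that by (cases i k rule: linorder_cases) auto
  have gt: "H $$ (k, k) > 1" using k pos[OF k(1)] by simp
  \<comment> \<open>Each factorization of this entry induces one of \<open>H\<close>; a factor of
    determinant 1 or -1 makes \<open>b\<close> or \<open>c\<close> a unit.\<close>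
  have "irreducible (H $$ (k, k))"
  proof (rule irreducibleI)
    fix b c assume "H $$ (k, k) = b * c"
    then have "\<bar>b\<bar> = 1 \<or> \<bar>c\<bar> = 1" using factor[OF k(1)] unit_factor by blast
    then show "b dvd 1 \<or> c dvd 1" by simp
  qed (use gt in auto)
  then have "prime (H $$ (k, k))"
    using gt by (intro primeI irreducible_imp_prime_elem) simp_all
  with k(1) gt others show thesis using that by blast
qed

section \<open>The shape of the normal form of a prime matrix\<close>

theorem proposition3:
  fixes D :: nat and A :: "int mat"
  assumes "D > 1"
    and "prime_mat D A"
    and "\<not> unimodular_mat A"
  shows "(\<exists>!H. is_hermite_normal_form D A H) \<and>
    (\<forall>H. is_hermite_normal_form D A H \<longrightarrow>
      (\<forall>m<D. \<forall>n<D. n > m \<longrightarrow> H $$ (m, n) = 0) \<and>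
      (\<exists>!m0. m0 < D \<and> H $$ (m0, m0) \<noteq> 1) \<and>
      (\<exists>m0<D. \<exists>l::int.
         H $$ (m0, m0) = l \<and> l > 1 \<and> prime l \<and>
         (\<forall>m<D. m \<noteq> m0 \<longrightarrow> H $$ (m, m) = 1) \<and>
         (\<forall>m<D. m \<noteq> m0 \<longrightarrow> (\<forall>n<m. H $$ (m, n) = 0)) \<and>
         (\<forall>n<m0. 0 \<le> H $$ (m0, n) \<and> H $$ (m0, n) < H $$ (m0, m0)) \<and>
         (\<exists>a :: nat \<Rightarrow> int.
            (\<forall>n<m0. 0 \<le> a n \<and> a n < l) \<and>
            H = mat D D (\<lambda>(m, n).
                  if m = n then (if m = m0 then l else 1)
                  else if m = m0 \<and> n < m0 then a n
                  else 0))))"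
proof (intro conjI allI impI)
  have A: "A \<in> carrier_mat D D" "det A \<noteq> 0" using assms(2) by (auto simp: prime_mat_def)
  show "\<exists>!H. is_hermite_normal_form D A H"
    using hermite_normal_form_exists[OF A] hermite_normal_form_unique by blast
next
  fix H assume herm: "is_hermite_normal_form D A H"
  then have H: "H \<in> carrier_mat D D" and up: "\<And>i j. i < j \<Longrightarrow> j < D \<Longrightarrow> H $$ (i, j) = 0"
    and low: "\<And>i j. j < i \<Longrightarrow> i < D \<Longrightarrow> 0 \<le> H $$ (i, j) \<and> H $$ (i, j) < H $$ (i, i)"
    unfolding is_hermite_normal_form_def by auto
  show "H $$ (m, n) = 0" if "m < D" "n < D" "m < n" for m n using up that by simp
  obtain k where k: "k < D" "H $$ (k, k) > 1" "prime (H $$ (k, k))"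
    and one: "\<And>i. i < D \<Longrightarrow> i \<noteq> k \<Longrightarrow> H $$ (i, i) = 1"
    using prime_hermite_normal_form_diagonal[OF herm assms(2,3)] by blast
  show "\<exists>!m0. m0 < D \<and> H $$ (m0, m0) \<noteq> 1"
    using k one by (intro ex1I[of _ k]) auto
  \<comment> \<open>The reduction bounds confine these entries to the integers from 0 up to but
    excluding the diagonal entry 1.\<close>
  have zero: "H $$ (m, n) = 0" if "m < D" "m \<noteq> k" "n < m" for m n
    using low[of n m] one[of m] that by simp
  \<comment> \<open>The witness for \<open>a\<close> is row \<open>k\<close> of \<open>H\<close>
    itself, read only at positions before \<open>k\<close>.\<close>
  have "H = mat D D (\<lambda>(m, n). if m = n then (if m = k then H $$ (k, k) else 1)
      else if m = k \<and> n < k then H $$ (k, n) else 0)" (is "H = ?M")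
  proof (rule eq_matI)
    fix i j assume "i < dim_row ?M" "j < dim_col ?M"
    then show "H $$ (i, j) = ?M $$ (i, j)"
      using one zero up by (cases i j rule: linorder_cases) auto
  qed (use H in auto)
  then show "\<exists>m0<D. \<exists>l::int.
         H $$ (m0, m0) = l \<and> l > 1 \<and> prime l \<and>
         (\<forall>m<D. m \<noteq> m0 \<longrightarrow> H $$ (m, m) = 1) \<and>
         (\<forall>m<D. m \<noteq> m0 \<longrightarrow> (\<forall>n<m. H $$ (m, n) = 0)) \<and>
         (\<forall>n<m0. 0 \<le> H $$ (m0, n) \<and> H $$ (m0, n) < H $$ (m0, m0)) \<and>
         (\<exists>a :: nat \<Rightarrow> int.
            (\<forall>n<m0. 0 \<le> a n \<and> a n < l) \<and>
            H = mat D D (\<lambda>(m, n).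
                  if m = n then (if m = m0 then l else 1)
                  else if m = m0 \<and> n < m0 then a n
                  else 0))"
    using k one zero low
    by (intro exI[of _ k] conjI exI[of _ "H $$ (k, k)"] exI[of _ "\<lambda>n. H $$ (k, n)"]) auto
qed

end
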